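(* Let $M$ be a finitely generated monoid. Then every small extension of every finitely presented $M$-act is finitely presented; that is, if $A$ is an $M$-act and $B$ is a subact of $A$ such that $A\setminus B$ is finite and $B$ is finitely presented, then $A$ is finitely presented.
   Context: Let $M$ be a monoid with identity $1$. A (right) $M$-act is a non-empty set $A$ with a map $A\times M\to A$, $(a,m)\mapsto am$, with $a(mn)=(am)n$ and $a1=a$. A subact of $A$ is a non-empty subset $B$ with $bm\in B$ for all $b\in B$, $m\in M$. If $B$ is a subact of $A$ with $A\setminus B$ finite, then $B$ is called large in $A$ and $A$ is called a small extension of $B$. A congruence on $A$ is an equivalence relation $\rho$ with $(a,b)\in\rho\Rightarrow(am,bm)\in\rho$ for all $m\in M$. For a set $X$, $F_X=X\times M$ is the free $M$-act with $(x,m)n=(x,mn)$. A presentation $\langle X\,|\,R\rangle$ consists of a non-empty set $X$ and a set $R\subseteq F_X\times F_X$; an $M$-act is defined by it if it is isomorphic to $F_X/\rho$, where $\rho$ is the smallest congruence on $F_X$ containing $R$. An $M$-act is finitely presented if it is defined by some presentation $\langle X\,|\,R\rangle$ with $X$ and $R$ finite. *)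

theory Defs
  imports "HOL-Algebra.Group"
begin

text \<open>Monoids are HOL-Algebra monoids \<open>M\<close>. A right act is given by its carrier \<open>A\<close> and an
  action \<open>act\<close>, of which only the values on \<open>A\<close> and \<open>carrier M\<close> are relevant. A subact is
  therefore just a subset \<open>B\<close>, regarded as an act with the same \<open>act\<close>.\<close>

definition generated_submonoid :: "('m, 'c) monoid_scheme \<Rightarrow> 'm set \<Rightarrow> 'm set" where
  "generated_submonoid M S = \<Inter>{H. submonoid H M \<and> S \<subseteq> H}"

definition finitely_generated_monoid :: "('m, 'c) monoid_scheme \<Rightarrow> bool" where
  "finitely_generated_monoid M \<longleftrightarrow>
     monoid M \<and> (\<exists>S. finite S \<and> S \<subseteq> carrier M \<and> generated_submonoid M S = carrier M)"

locale monoid_act = monoid M for M :: "('m, 'c) monoid_scheme" (structure) +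
  fixes A :: "'a set" and act :: "'a \<Rightarrow> 'm \<Rightarrow> 'a"
  assumes nonempty: "A \<noteq> {}"
    and act_closed: "\<lbrakk>a \<in> A; m \<in> carrier M\<rbrakk> \<Longrightarrow> act a m \<in> A"
    and act_mult: "\<lbrakk>a \<in> A; m \<in> carrier M; n \<in> carrier M\<rbrakk> \<Longrightarrow> act a (m \<otimes> n) = act (act a m) n"
    and act_one: "a \<in> A \<Longrightarrow> act a \<one> = a"

definition subact ::
  "('m, 'c) monoid_scheme \<Rightarrow> 'a set \<Rightarrow> ('a \<Rightarrow> 'm \<Rightarrow> 'a) \<Rightarrow> 'a set \<Rightarrow> bool" where
  "subact M A act B \<longleftrightarrow> B \<noteq> {} \<and> B \<subseteq> A \<and> (\<forall>b\<in>B. \<forall>m\<in>carrier M. act b m \<in> B)"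

text \<open>\<open>small_extension M A act B\<close>: the act \<open>A\<close> is a small extension of its subact \<open>B\<close>,
  i.e. \<open>B\<close> is large in \<open>A\<close>.\<close>

definition small_extension ::
  "('m, 'c) monoid_scheme \<Rightarrow> 'a set \<Rightarrow> ('a \<Rightarrow> 'm \<Rightarrow> 'a) \<Rightarrow> 'a set \<Rightarrow> bool" where
  "small_extension M A act B \<longleftrightarrow> monoid_act M A act \<and> subact M A act B \<and> finite (A - B)"

definition act_congruence ::
  "('m, 'c) monoid_scheme \<Rightarrow> 'a set \<Rightarrow> ('a \<Rightarrow> 'm \<Rightarrow> 'a) \<Rightarrow> ('a \<times> 'a) set \<Rightarrow> bool" where
  "act_congruence M A act \<rho> \<longleftrightarrow>
     equiv A \<rho> \<and> (\<forall>(a, b)\<in>\<rho>. \<forall>m\<in>carrier M. (act a m, act b m) \<in> \<rho>)"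

definition generated_congruence ::
  "('m, 'c) monoid_scheme \<Rightarrow> 'a set \<Rightarrow> ('a \<Rightarrow> 'm \<Rightarrow> 'a) \<Rightarrow> ('a \<times> 'a) set \<Rightarrow> ('a \<times> 'a) set" where
  "generated_congruence M A act R = \<Inter>{\<rho>. act_congruence M A act \<rho> \<and> R \<subseteq> \<rho>}"

text \<open>The action on the quotient \<open>A // \<rho>\<close>: the class of \<open>a\<close> is sent by \<open>m\<close> to the class of
  \<open>act a m\<close>; see \<open>quotient_act_class\<close> below.\<close>

definition quotient_act :: "('a \<Rightarrow> 'm \<Rightarrow> 'a) \<Rightarrow> ('a \<times> 'a) set \<Rightarrow> 'a set \<Rightarrow> 'm \<Rightarrow> 'a set" where
  "quotient_act act \<rho> C m = \<rho> `` ((\<lambda>a. act a m) ` C)"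

definition act_isomorphic ::
  "('m, 'c) monoid_scheme \<Rightarrow> 'a set \<Rightarrow> ('a \<Rightarrow> 'm \<Rightarrow> 'a) \<Rightarrow> 'b set \<Rightarrow> ('b \<Rightarrow> 'm \<Rightarrow> 'b) \<Rightarrow> bool" where
  "act_isomorphic M A act A' act' \<longleftrightarrow>
     (\<exists>\<phi>. bij_betw \<phi> A A' \<and> (\<forall>a\<in>A. \<forall>m\<in>carrier M. \<phi> (act a m) = act' (\<phi> a) m))"

definition free_carrier :: "('m, 'c) monoid_scheme \<Rightarrow> 'x set \<Rightarrow> ('x \<times> 'm) set" where
  "free_carrier M X = X \<times> carrier M"

definition free_act :: "('m, 'c) monoid_scheme \<Rightarrow> 'x \<times> 'm \<Rightarrow> 'm \<Rightarrow> 'x \<times> 'm" where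
  "free_act M = (\<lambda>(x, m) n. (x, m \<otimes>\<^bsub>M\<^esub> n))"

definition is_presentation ::
  "('m, 'c) monoid_scheme \<Rightarrow> 'x set \<Rightarrow> (('x \<times> 'm) \<times> ('x \<times> 'm)) set \<Rightarrow> bool" where
  "is_presentation M X R \<longleftrightarrow> X \<noteq> {} \<and> R \<subseteq> free_carrier M X \<times> free_carrier M X"

definition act_defined_by ::
  "('m, 'c) monoid_scheme \<Rightarrow> 'a set \<Rightarrow> ('a \<Rightarrow> 'm \<Rightarrow> 'a) \<Rightarrow>
   'x set \<Rightarrow> (('x \<times> 'm) \<times> ('x \<times> 'm)) set \<Rightarrow> bool" where
  "act_defined_by M A act X R \<longleftrightarrow>
     (let \<rho> = generated_congruence M (free_carrier M X) (free_act M) R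
      in act_isomorphic M A act (free_carrier M X // \<rho>) (quotient_act (free_act M) \<rho>))"

text \<open>HOL cannot quantify over the type of the generating symbols, so they are taken to be natural
  numbers. This is no restriction for finite \<open>X\<close>; see \<open>finitely_presented_actI\<close> below.\<close>

definition finitely_presented_act ::
  "('m, 'c) monoid_scheme \<Rightarrow> 'a set \<Rightarrow> ('a \<Rightarrow> 'm \<Rightarrow> 'a) \<Rightarrow> bool" where
  "finitely_presented_act M A act \<longleftrightarrow> monoid_act M A act \<and>
     (\<exists>(X :: nat set) R. finite X \<and> finite R \<and> is_presentation M X R \<and> act_defined_by M A act X R)"


lemma free_monoid_act:
  assumes "monoid M" "X \<noteq> {}"
  shows "monoid_act M (free_carrier M X) (free_act M)"
proof -
  interpret monoid M by fact
  show ?thesis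
    using assms(2) by unfold_locales (auto simp: free_carrier_def free_act_def m_assoc)
qed

lemma (in monoid_act) act_congruence_generated:
  assumes "R \<subseteq> A \<times> A"
  shows "act_congruence M A act (generated_congruence M A act R)"
proof -
  have full: "act_congruence M A act (A \<times> A)"
    unfolding act_congruence_def equiv_def refl_on_def sym_def trans_def
    using act_closed by auto
  let ?S = "{\<rho>. act_congruence M A act \<rho> \<and> R \<subseteq> \<rho>}"
  have mem: "A \<times> A \<in> ?S" using full assms by simp
  have 1: "\<Inter>?S \<subseteq> A \<times> A" using mem by blast
  have 2: "refl_on A (\<Inter>?S)"
    unfolding refl_on_def act_congruence_def equiv_def by blast
  have 3: "sym (\<Inter>?S)"
    unfolding sym_def act_congruence_def equiv_def by blast
  have 4: "trans (\<Inter>?S)"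
    by (rule trans_INTER[of ?S "\<lambda>\<rho>. \<rho>", simplified image_ident])
      (simp add: act_congruence_def equiv_def)
  have 5: "\<forall>(a, b)\<in>\<Inter>?S. \<forall>m\<in>carrier M. (act a m, act b m) \<in> \<Inter>?S"
    unfolding act_congruence_def by fast
  show ?thesis
    unfolding generated_congruence_def act_congruence_def[of M A act "\<Inter>?S"] equiv_def
    using 1 2 3 4 5 by blast
qed

lemma quotient_act_class:
  assumes "act_congruence M A act \<rho>" "a \<in> A" "m \<in> carrier M"
  shows "quotient_act act \<rho> (\<rho> `` {a}) m = \<rho> `` {act a m}"
proof -
  have eq: "equiv A \<rho>" and c: "\<And>b. (a, b) \<in> \<rho> \<Longrightarrow> (act a m, act b m) \<in> \<rho>"
    using assms unfolding act_congruence_def by auto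
  have "a \<in> \<rho> `` {a}" using eq assms(2) by (rule equiv_class_self)
  moreover have "\<rho> `` {act b m} = \<rho> `` {act a m}" if "b \<in> \<rho> `` {a}" for b
    using equiv_class_eq[OF eq c] that by auto
  ultimately show ?thesis
    unfolding quotient_act_def by blast
qed

lemma (in monoid_act) quotient_monoid_act:
  assumes "act_congruence M A act \<rho>"
  shows "monoid_act M (A // \<rho>) (quotient_act act \<rho>)"
proof unfold_locales
  note cls = quotient_act_class[OF assms]
  show "A // \<rho> \<noteq> {}" using nonempty by (auto simp: quotient_def)
  show "quotient_act act \<rho> C m \<in> A // \<rho>" if "C \<in> A // \<rho>" "m \<in> carrier M" for C m
    using that(1) by (rule quotientE) (simp add: cls that act_closed quotientI)
  show "quotient_act act \<rho> C (m \<otimes> n) = quotient_act act \<rho> (quotient_act act \<rho> C m) n"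
    if "C \<in> A // \<rho>" "m \<in> carrier M" "n \<in> carrier M" for C m n
    using that(1) by (rule quotientE) (simp add: cls that act_closed act_mult)
  show "quotient_act act \<rho> C \<one> = C" if "C \<in> A // \<rho>" for C
    using that by (rule quotientE) (simp add: cls act_one)
qed

lemma act_isomorphic_trans:
  assumes "act_isomorphic M A act A' act'" "act_isomorphic M A' act' A'' act''"
  shows "act_isomorphic M A act A'' act''"
proof -
  obtain f g where "bij_betw f A A'" "\<forall>a\<in>A. \<forall>m\<in>carrier M. f (act a m) = act' (f a) m"
    "bij_betw g A' A''" "\<forall>a\<in>A'. \<forall>m\<in>carrier M. g (act' a m) = act'' (g a) m"
    using assms unfolding act_isomorphic_def by auto
  then have "bij_betw (g \<circ> f) A A'' \<and>
      (\<forall>a\<in>A. \<forall>m\<in>carrier M. (g \<circ> f) (act a m) = act'' ((g \<circ> f) a) m)"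
    using bij_betw_trans bij_betwE by fastforce
  then show ?thesis unfolding act_isomorphic_def by blast
qed

text \<open>The pullback of a congruence along a homomorphism is a congruence.\<close>

lemma act_congruence_pullback:
  assumes "act_congruence M A' act' \<sigma>" "monoid_act M A act" "h \<in> A \<rightarrow> A'"
    and hom: "\<And>a m. a \<in> A \<Longrightarrow> m \<in> carrier M \<Longrightarrow> h (act a m) = act' (h a) m"
  shows "act_congruence M A act {(a, b). a \<in> A \<and> b \<in> A \<and> (h a, h b) \<in> \<sigma>}"
proof -
  interpret monoid_act M A act by fact
  have eq: "refl_on A' \<sigma>" "sym \<sigma>" "trans \<sigma>"
    and c: "\<And>a b m. (a, b) \<in> \<sigma> \<Longrightarrow> m \<in> carrier M \<Longrightarrow> (act' a m, act' b m) \<in> \<sigma>"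
    using assms(1) unfolding act_congruence_def equiv_def by auto
  have "equiv A {(a, b). a \<in> A \<and> b \<in> A \<and> (h a, h b) \<in> \<sigma>}"
  proof (rule equivI)
    show "refl_on A {(a, b). a \<in> A \<and> b \<in> A \<and> (h a, h b) \<in> \<sigma>}"
      using eq(1) assms(3) unfolding refl_on_def by auto
    show "sym {(a, b). a \<in> A \<and> b \<in> A \<and> (h a, h b) \<in> \<sigma>}"
      using eq(2) unfolding sym_def by auto
    show "trans {(a, b). a \<in> A \<and> b \<in> A \<and> (h a, h b) \<in> \<sigma>}"
      using eq(3) unfolding trans_def by blast
  qed auto
  then show ?thesis
    unfolding act_congruence_def using c hom act_closed by auto
qed

lemma generated_congruence_hom:
  assumes "monoid_act M A act" "monoid_act M A' act'" "h \<in> A \<rightarrow> A'"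
    and "\<And>a m. a \<in> A \<Longrightarrow> m \<in> carrier M \<Longrightarrow> h (act a m) = act' (h a) m"
    and R: "R \<subseteq> A \<times> A" and R': "R' \<subseteq> A' \<times> A'" and RR: "map_prod h h ` R \<subseteq> R'"
    and ab: "(a, b) \<in> generated_congruence M A act R"
  shows "(h a, h b) \<in> generated_congruence M A' act' R'"
proof -
  let ?\<sigma> = "generated_congruence M A' act' R'"
  let ?P = "{(a, b). a \<in> A \<and> b \<in> A \<and> (h a, h b) \<in> ?\<sigma>}"
  have "act_congruence M A act ?P"
    using act_congruence_pullback[OF monoid_act.act_congruence_generated[OF assms(2) R']]
      assms(1,3,4) by blast
  moreover have "R' \<subseteq> ?\<sigma>" unfolding generated_congruence_def by blast
  then have "R \<subseteq> ?P" using R RR by force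
  ultimately show ?thesis using ab unfolding generated_congruence_def[of M A] by blast
qed

text \<open>A finite presentation over generating symbols of any type may be used.\<close>

lemma finitely_presented_actI:
  fixes M :: "('m, 'c) monoid_scheme" and X :: "'x set"
  assumes act: "monoid_act M A act" and fin: "finite X" "finite R"
    and pres: "is_presentation M X R" and iso: "act_defined_by M A act X R"
  shows "finitely_presented_act M A act"
proof -
  interpret monoid_act M A act by fact
  obtain f :: "'x \<Rightarrow> nat" where f: "inj_on f X"
    using fin(1) finite_imp_inj_to_nat_seg by blast
  define Y where "Y = f ` X"
  define h where "h = map_prod f (\<lambda>m :: 'm. m)"
  define k where "k = map_prod (inv_into X f) (\<lambda>m :: 'm. m)"
  define R' where "R' = map_prod h h ` R"
  let ?F = "free_carrier M X" and ?G = "free_carrier M Y" and ?a = "free_act M :: 'x \<times> 'm \<Rightarrow> _"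
  let ?b = "free_act M :: nat \<times> 'm \<Rightarrow> _"
  have X: "X \<noteq> {}" and R: "R \<subseteq> ?F \<times> ?F" using pres by (auto simp: is_presentation_def)
  have Y: "Y \<noteq> {}" using X by (simp add: Y_def)
  have h: "h \<in> ?F \<rightarrow> ?G" by (auto simp: h_def free_carrier_def Y_def)
  have k: "k \<in> ?G \<rightarrow> ?F" by (auto simp: k_def free_carrier_def Y_def f)
  have kh: "k (h p) = p" if "p \<in> ?F" for p
    using that f by (auto simp: k_def h_def free_carrier_def)
  have hk: "h (k q) = q" if "q \<in> ?G" for q
    using that f by (auto simp: k_def h_def free_carrier_def Y_def)
  have hact: "h (free_act M p m) = free_act M (h p) m" for p m
    by (cases p) (simp add: h_def free_act_def)
  have kact: "k (free_act M q m) = free_act M (k q) m" for q m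
    by (cases q) (simp add: k_def free_act_def)
  have R': "R' \<subseteq> ?G \<times> ?G" using R h unfolding R'_def by force
  have RR: "map_prod k k ` R' \<subseteq> R" using R kh unfolding R'_def by force
  note F = free_monoid_act[OF monoid_axioms X] and G = free_monoid_act[OF monoid_axioms Y]
  define \<rho> where "\<rho> = generated_congruence M ?F ?a R"
  define \<sigma> where "\<sigma> = generated_congruence M ?G ?b R'"
  have c\<rho>: "act_congruence M ?F ?a \<rho>" and c\<sigma>: "act_congruence M ?G ?b \<sigma>"
    unfolding \<rho>_def \<sigma>_def
    by (intro monoid_act.act_congruence_generated F G R R')+
  have e\<rho>: "equiv ?F \<rho>" and e\<sigma>: "equiv ?G \<sigma>"
    using c\<rho> c\<sigma> unfolding act_congruence_def by auto
  have h1: "(h p, h q) \<in> \<sigma>" if "(p, q) \<in> \<rho>" for p q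
    using generated_congruence_hom[OF F G h hact R R' _ that[unfolded \<rho>_def]]
    unfolding \<sigma>_def R'_def by simp
  have k1: "(k p, k q) \<in> \<rho>" if "(p, q) \<in> \<sigma>" for p q
    using generated_congruence_hom[OF G F k kact R' R RR that[unfolded \<sigma>_def]]
    unfolding \<rho>_def by simp
  have img: "h ` (\<rho> `` {p}) = \<sigma> `` {h p}" if p: "p \<in> ?F" for p
  proof
    show "h ` (\<rho> `` {p}) \<subseteq> \<sigma> `` {h p}" using h1 by auto
    show "\<sigma> `` {h p} \<subseteq> h ` (\<rho> `` {p})"
    proof
      fix q assume "q \<in> \<sigma> `` {h p}"
      then have q: "(h p, q) \<in> \<sigma>" by simp
      then have "q \<in> ?G" using e\<sigma> unfolding equiv_def by auto
      then have "q = h (k q)" using hk by simp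
      moreover have "k q \<in> \<rho> `` {p}" using k1[OF q] kh[OF p] by simp
      ultimately show "q \<in> h ` (\<rho> `` {p})" by (rule image_eqI)
    qed
  qed
  have "inj_on h ?F" using kh by (metis inj_onI)
  then have inj: "inj_on (image h) (?F // \<rho>)"
    using in_quotient_imp_subset[OF e\<rho>] by (meson inj_onI inj_on_image_eq_iff)
  have surj: "image h ` (?F // \<rho>) = ?G // \<sigma>"
  proof
    show "image h ` (?F // \<rho>) \<subseteq> ?G // \<sigma>"
    proof (rule image_subsetI)
      fix C assume "C \<in> ?F // \<rho>"
      then obtain p where p: "p \<in> ?F" "C = \<rho> `` {p}" by (rule quotientE)
      then have "h p \<in> ?G" using h by auto
      then show "h ` C \<in> ?G // \<sigma>" unfolding p(2) img[OF p(1)] by (rule quotientI)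
    qed
    show "?G // \<sigma> \<subseteq> image h ` (?F // \<rho>)"
    proof
      fix D assume "D \<in> ?G // \<sigma>"
      then obtain q where q: "q \<in> ?G" "D = \<sigma> `` {q}" by (rule quotientE)
      then have kq: "k q \<in> ?F" using k by auto
      then have "D = h ` (\<rho> `` {k q})" using img hk q by simp
      then show "D \<in> image h ` (?F // \<rho>)" using quotientI[OF kq] by blast
    qed
  qed
  have hom: "h ` quotient_act ?a \<rho> C m = quotient_act ?b \<sigma> (h ` C) m"
    if C: "C \<in> ?F // \<rho>" and m: "m \<in> carrier M" for C m
  proof -
    obtain p where p: "p \<in> ?F" "C = \<rho> `` {p}" using C by (rule quotientE)
    have pm: "?a p m \<in> ?F" using monoid_act.act_closed[OF F p(1) m] .
    have hp: "h p \<in> ?G" using h p(1) by auto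
    show ?thesis
      by (simp add: p(2) quotient_act_class[OF c\<rho> p(1) m] img[OF pm] img[OF p(1)]
          quotient_act_class[OF c\<sigma> hp m] hact)
  qed
  have "act_isomorphic M (?F // \<rho>) (quotient_act ?a \<rho>) (?G // \<sigma>) (quotient_act ?b \<sigma>)"
    unfolding act_isomorphic_def bij_betw_def
    by (rule exI[of _ "image h"], intro conjI ballI inj surj hom)
  then have "act_defined_by M A act Y R'"
    unfolding act_defined_by_def Let_def \<rho>_def \<sigma>_def
    by (rule act_isomorphic_trans[OF iso[unfolded act_defined_by_def Let_def]])
  moreover have "finite Y" "finite R'" "is_presentation M Y R'"
    using fin Y R' by (auto simp: Y_def R'_def is_presentation_def)
  ultimately show ?thesis
    using act unfolding finitely_presented_act_def by blast
qed

end

(* Present B by generators X and relations R, and let S be a finite generating set of M. Then A is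
   generated by X together with C = A - B. Each element a of A has a normal form w a: the generator a
   itself if a is in C, and a fixed element of F_X representing a otherwise. The relations R together
   with the finitely many relations c s = w (c s), for c in C and s in S, suffice: the monoid
   elements m such that they imply w a m = w (a m) for all a in A form a submonoid containing S, so
   every element of the free act can be brought into normal form. *)

theory Submission
  imports Defs
begin

text \<open>First isomorphism theorem for acts: an isomorphism onto the quotient amounts to a
  surjective homomorphism from the free act whose kernel is the generated congruence. This lets the
  main proof compute with elements of the free acts instead of classes.\<close>

lemma act_defined_by_iff:
  assumes A: "monoid_act M A act" and pres: "is_presentation M X R"
  shows "act_defined_by M A act X R \<longleftrightarrow>
    (\<exists>\<theta>. \<theta> ` free_carrier M X = A \<and>
      (\<forall>p\<in>free_carrier M X. \<forall>m\<in>carrier M. \<theta> (free_act M p m) = act (\<theta> p) m) \<and>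
      (\<forall>p\<in>free_carrier M X. \<forall>q\<in>free_carrier M X.
        \<theta> p = \<theta> q \<longleftrightarrow> (p, q) \<in> generated_congruence M (free_carrier M X) (free_act M) R))"
    (is "?L \<longleftrightarrow> _")
proof -
  interpret A: monoid_act M A act by fact
  define F where "F = free_carrier M X"
  define \<rho> where "\<rho> = generated_congruence M F (free_act M) R"
  have X: "X \<noteq> {}" and R: "R \<subseteq> F \<times> F" using pres by (auto simp: is_presentation_def F_def)
  interpret F: monoid_act M F "free_act M"
    unfolding F_def by (rule free_monoid_act[OF A.monoid_axioms X])
  have c: "act_congruence M F (free_act M) \<rho>"
    unfolding \<rho>_def by (rule F.act_congruence_generated[OF R])
  then have e: "equiv F \<rho>" unfolding act_congruence_def by simp
  note cls = quotient_act_class[OF c]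
  have L: "?L \<longleftrightarrow> act_isomorphic M A act (F // \<rho>) (quotient_act (free_act M) \<rho>)"
    unfolding act_defined_by_def Let_def F_def \<rho>_def ..
  have "(\<exists>\<theta>. \<theta> ` F = A \<and> (\<forall>p\<in>F. \<forall>m\<in>carrier M. \<theta> (free_act M p m) = act (\<theta> p) m) \<and>
      (\<forall>p\<in>F. \<forall>q\<in>F. \<theta> p = \<theta> q \<longleftrightarrow> (p, q) \<in> \<rho>))" if iso: ?L
  proof -
    obtain \<phi> where bij: "bij_betw \<phi> A (F // \<rho>)"
      and hom: "\<And>a m. a \<in> A \<Longrightarrow> m \<in> carrier M \<Longrightarrow>
        \<phi> (act a m) = quotient_act (free_act M) \<rho> (\<phi> a) m"
      using iso unfolding L act_isomorphic_def by blast
    \<comment> \<open>The projection onto the quotient followed by the inverse of the isomorphism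
      \<phi>.\<close>
    define \<theta> where "\<theta> p = inv_into A \<phi> (\<rho> `` {p})" for p
    have \<theta>A: "\<theta> p \<in> A" and \<phi>\<theta>: "\<phi> (\<theta> p) = \<rho> `` {p}" if "p \<in> F" for p
      using bij_betw_apply[OF bij_betw_inv_into[OF bij]] bij_betw_inv_into_right[OF bij]
        quotientI[OF that] unfolding \<theta>_def by auto
    \<comment> \<open>By injectivity of \<phi>, values of \<theta> can be identified by comparing
      classes; surjectivity and compatibility with the action both follow this way.\<close>
    have \<theta>\<phi>: "\<theta> p = a" if "\<phi> a = \<rho> `` {p}" "a \<in> A" for a p
      unfolding \<theta>_def using bij_betw_inv_into_left[OF bij that(2)] that(1) by simp
    have surj: "\<theta> ` F = A"
    proof
      show "\<theta> ` F \<subseteq> A" using \<theta>A by auto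
      show "A \<subseteq> \<theta> ` F"
      proof
        fix a assume a: "a \<in> A"
        then have "\<phi> a \<in> F // \<rho>" using bij bij_betwE by blast
        then obtain p where "p \<in> F" "\<phi> a = \<rho> `` {p}" by (rule quotientE)
        then show "a \<in> \<theta> ` F" using \<theta>\<phi>[OF _ a] by blast
      qed
    qed
    have "\<theta> (free_act M p m) = act (\<theta> p) m" if p: "p \<in> F" and m: "m \<in> carrier M" for p m
      by (rule \<theta>\<phi>) (simp_all add: hom \<theta>A \<phi>\<theta> cls p m A.act_closed)
    moreover have "\<theta> p = \<theta> q \<longleftrightarrow> (p, q) \<in> \<rho>" if "p \<in> F" "q \<in> F" for p q
      using that \<phi>\<theta> eq_equiv_class_iff[OF e that] by (metis \<theta>_def)
    ultimately show ?thesis using surj by blast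
  qed
  moreover have ?L
    if surj: "\<theta> ` F = A"
      and hom: "\<forall>p\<in>F. \<forall>m\<in>carrier M. \<theta> (free_act M p m) = act (\<theta> p) m"
      and ker: "\<forall>p\<in>F. \<forall>q\<in>F. \<theta> p = \<theta> q \<longleftrightarrow> (p, q) \<in> \<rho>" for \<theta>
  proof -
    \<comment> \<open>A section of \<theta>, in general not a homomorphism. Since the kernel of
      \<theta> is \<rho>, the class of \<open>r a\<close> does not depend on the choice, and passing
      to classes gives the inverse of the map induced by \<theta>.\<close>
    define r where "r a = inv_into F \<theta> a" for a
    have r: "r a \<in> F" "\<theta> (r a) = a" if "a \<in> A" for a
      using that surj unfolding r_def by (auto intro: inv_into_into f_inv_into_f)
    have r\<theta>: "\<rho> `` {r a} = \<rho> `` {p}" if "a \<in> A" "p \<in> F" "\<theta> p = a" for a p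
      by (rule equiv_class_eq[OF e]) (use ker r[OF that(1)] that in auto)
    have "bij_betw (\<lambda>a. \<rho> `` {r a}) A (F // \<rho>)"
      unfolding bij_betw_def
    proof (intro conjI inj_onI equalityI subsetI)
      fix a b assume ab: "a \<in> A" "b \<in> A" "\<rho> `` {r a} = \<rho> `` {r b}"
      then have "(r a, r b) \<in> \<rho>" using eq_equiv_class_iff[OF e r(1) r(1)] by simp
      then show "a = b" using ker r ab by metis
    next
      fix D assume "D \<in> F // \<rho>"
      then obtain p where p: "p \<in> F" "D = \<rho> `` {p}" by (rule quotientE)
      then have "\<theta> p \<in> A" using surj by blast
      then show "D \<in> (\<lambda>a. \<rho> `` {r a}) ` A" using r\<theta> p by blast
    qed (auto intro: quotientI r)
    moreover have "\<rho> `` {r (act a m)} = quotient_act (free_act M) \<rho> (\<rho> `` {r a}) m"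
      if "a \<in> A" "m \<in> carrier M" for a m
      unfolding cls[OF r(1)[OF that(1)] that(2)]
      by (rule r\<theta>) (use that r hom in \<open>simp_all add: A.act_closed F.act_closed\<close>)
    ultimately show ?thesis unfolding L act_isomorphic_def by blast
  qed
  ultimately show ?thesis unfolding F_def \<rho>_def by blast
qed

theorem corollary6p9:
  fixes M :: "('m, 'c) monoid_scheme"
    and A B :: "'a set"
    and act :: "'a \<Rightarrow> 'm \<Rightarrow> 'a"
  assumes "finitely_generated_monoid M"
    and "small_extension M A act B"
    and "finitely_presented_act M B act"
  shows "finitely_presented_act M A act"
proof -
  obtain S where S: "finite S" "S \<subseteq> carrier M" "generated_submonoid M S = carrier M"
    using assms(1) unfolding finitely_generated_monoid_def by blast
  have A: "monoid_act M A act" and BA: "B \<subseteq> A" and fin: "finite (A - B)"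
    using assms(2) unfolding small_extension_def subact_def by auto
  obtain X :: "nat set" and R where B: "monoid_act M B act" and XR: "finite X" "finite R"
    and pres: "is_presentation M X R" and dB: "act_defined_by M B act X R"
    using assms(3) unfolding finitely_presented_act_def by blast
  interpret A: monoid_act M A act by fact
  interpret B: monoid_act M B act by fact
  define C where "C = A - B"
  define F where "F = free_carrier M X"
  have X: "X \<noteq> {}" and R: "R \<subseteq> F \<times> F" using pres by (auto simp: is_presentation_def F_def)
  obtain \<theta> where \<theta>: "\<theta> ` F = B"
      "\<And>p m. p \<in> F \<Longrightarrow> m \<in> carrier M \<Longrightarrow> \<theta> (free_act M p m) = act (\<theta> p) m"
      "\<And>p q. p \<in> F \<Longrightarrow> q \<in> F \<Longrightarrow>
        \<theta> p = \<theta> q \<longleftrightarrow> (p, q) \<in> generated_congruence M F (free_act M) R"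
    using iffD1[OF act_defined_by_iff[OF B pres] dB] unfolding F_def by blast
  \<comment> \<open>The elements of \<open>C\<close> themselves serve as new generating symbols. The
    sum keeps them apart from \<open>X\<close>; the symbols are traded for natural numbers only at
    the end, by \<open>finitely_presented_actI\<close>.\<close>
  define Y where "Y = X <+> C"
  define G where "G = free_carrier M Y"
  have Y: "Y \<noteq> {}" using X by (auto simp: Y_def)
  interpret F: monoid_act M F "free_act M"
    unfolding F_def by (rule free_monoid_act[OF A.monoid_axioms X])
  interpret G: monoid_act M G "free_act M"
    unfolding G_def by (rule free_monoid_act[OF A.monoid_axioms Y])
  define \<iota> :: "nat \<times> 'm \<Rightarrow> (nat + 'a) \<times> 'm" where "\<iota> = map_prod Inl (\<lambda>m. m)"
  \<comment> \<open>The homomorphism onto \<open>A\<close> that extends \<theta> and sends each new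
    generator to itself. The goal is that its kernel is \<sigma>; the map \<open>w\<close> below is
    a section of it.\<close>
  define h where "h = (\<lambda>(y, m). case y of Inl x \<Rightarrow> \<theta> (x, m) | Inr c \<Rightarrow> act c m)"
  define w where "w a = (if a \<in> C then (Inr a, \<one>\<^bsub>M\<^esub>) else \<iota> (inv_into F \<theta> a))" for a
  \<comment> \<open>One relation per pair suffices whether \<open>act c s\<close> stays in
    \<open>C\<close> or falls into \<open>B\<close>, because \<open>w\<close> covers both
    cases.\<close>
  define T :: "(((nat + 'a) \<times> 'm) \<times> ((nat + 'a) \<times> 'm)) set"
    where "T = (\<lambda>(c, s). ((Inr c, s), w (act c s))) ` (C \<times> S)"
  define R' where "R' = map_prod \<iota> \<iota> ` R \<union> T"
  define \<sigma> where "\<sigma> = generated_congruence M G (free_act M) R'"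
  have \<iota>: "\<iota> \<in> F \<rightarrow> G" by (auto simp: \<iota>_def F_def G_def free_carrier_def Y_def)
  have \<iota>_act: "\<iota> (free_act M p m) = free_act M (\<iota> p) m" for p m
    by (cases p) (simp add: \<iota>_def free_act_def)
  have h\<iota>: "h (\<iota> p) = \<theta> p" for p by (cases p) (simp add: h_def \<iota>_def)
  have inv: "inv_into F \<theta> b \<in> F" "\<theta> (inv_into F \<theta> b) = b" if "b \<in> B" for b
    using that \<theta>(1) by (auto intro: inv_into_into f_inv_into_f)
  have w: "w a \<in> G" "h (w a) = a" if "a \<in> A" for a
  proof -
    show "w a \<in> G"
    proof (cases "a \<in> C")
      case True
      then show ?thesis by (auto simp: w_def G_def free_carrier_def Y_def)
    next
      case False
      then have "inv_into F \<theta> a \<in> F" using that inv by (simp add: C_def)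
      then show ?thesis using \<iota> False by (auto simp: w_def)
    qed
    show "h (w a) = a"
      using that inv(2) h\<iota> A.act_one by (auto simp: w_def C_def h_def)
  qed
  have h_hom: "h p \<in> A \<and> h (free_act M p m) = act (h p) m"
    if pG: "p \<in> G" and m: "m \<in> carrier M" for p m
  proof -
    obtain y n where p: "p = (y, n)" "y \<in> Y" "n \<in> carrier M"
      using pG by (auto simp: G_def free_carrier_def)
    show ?thesis
    proof (cases y)
      case (Inl x)
      then have "(x, n) \<in> F" using p by (auto simp: Y_def F_def free_carrier_def)
      then show ?thesis
        using \<theta>(1) \<theta>(2)[of "(x, n)" m] BA m p Inl by (auto simp: h_def free_act_def)
    next
      case (Inr c)
      then have "c \<in> A" using p by (auto simp: Y_def C_def)
      then show ?thesis
        using p m Inr by (simp add: h_def free_act_def A.act_closed A.act_mult)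
    qed
  qed
  have hA: "h p \<in> A" if "p \<in> G" for p using h_hom[OF that A.one_closed] by blast
  have h_act: "h (free_act M p m) = act (h p) m" if "p \<in> G" "m \<in> carrier M" for p m
    using h_hom[OF that] by blast
  have T: "T \<subseteq> G \<times> G"
  proof -
    have "(Inr c, s) \<in> G" "w (act c s) \<in> G" if "c \<in> C" "s \<in> S" for c s
    proof -
      have cs: "c \<in> A" "s \<in> carrier M" using that S(2) by (auto simp: C_def)
      show "(Inr c, s) \<in> G" using that cs by (auto simp: G_def free_carrier_def Y_def)
      show "w (act c s) \<in> G" by (intro w(1) A.act_closed cs)
    qed
    then show ?thesis unfolding T_def by (intro image_subsetI) (auto split: prod.split)
  qed
  have R': "R' \<subseteq> G \<times> G" using R \<iota> T unfolding R'_def by force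
  have cong: "act_congruence M G (free_act M) \<sigma>"
    unfolding \<sigma>_def by (rule G.act_congruence_generated[OF R'])
  then have eq: "equiv G \<sigma>"
    and \<sigma>_act: "\<And>p q m. (p, q) \<in> \<sigma> \<Longrightarrow> m \<in> carrier M \<Longrightarrow> (free_act M p m, free_act M q m) \<in> \<sigma>"
    unfolding act_congruence_def by auto
  have \<sigma>_refl: "(p, p) \<in> \<sigma>" if "p \<in> G" for p
    using eq that by (auto simp: equiv_def refl_on_def)
  have \<sigma>_sym: "(q, p) \<in> \<sigma>" if "(p, q) \<in> \<sigma>" for p q
    using eq that by (auto simp: equiv_def dest: symD)
  have \<sigma>_trans: "(p, r) \<in> \<sigma>" if "(p, q) \<in> \<sigma>" "(q, r) \<in> \<sigma>" for p q r
    using eq that by (auto simp: equiv_def dest: transD)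
  have R'\<sigma>: "R' \<subseteq> \<sigma>" unfolding \<sigma>_def generated_congruence_def by blast
  \<comment> \<open>Both \<open>p\<close> and the chosen preimage of \<open>\<theta> p\<close> have
    the same value in \<open>B\<close>, so the presentation of \<open>B\<close> identifies them, and
    \<iota> carries this over to \<sigma>.\<close>
  have norm_\<iota>: "(\<iota> p, w (\<theta> p)) \<in> \<sigma>" if p: "p \<in> F" for p
  proof -
    let ?q = "inv_into F \<theta> (\<theta> p)"
    have b: "\<theta> p \<in> B" using \<theta>(1) p by blast
    have pq: "(p, ?q) \<in> generated_congruence M F (free_act M) R"
      using \<theta>(3)[OF p inv(1)[OF b]] inv(2)[OF b] by simp
    have "(\<iota> p, \<iota> ?q) \<in> \<sigma>"
      unfolding \<sigma>_def
      by (rule generated_congruence_hom[OF F.monoid_act_axioms G.monoid_act_axioms \<iota> \<iota>_act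
            R R' _ pq])
        (simp add: R'_def)
    then show ?thesis using b by (simp add: w_def C_def)
  qed
  \<comment> \<open>Ranging over all of \<open>A\<close> makes \<open>H\<close> closed under
    products: after \<open>m\<close> has acted, the condition on \<open>n\<close> is applied at
    \<open>act a m\<close>, which may lie in \<open>B\<close> even when \<open>a\<close> lies in
    \<open>C\<close>.\<close>
  define H where "H = {m \<in> carrier M. \<forall>a\<in>A. (free_act M (w a) m, w (act a m)) \<in> \<sigma>}"
  have "submonoid H M"
  proof
    show "H \<subseteq> carrier M" by (auto simp: H_def)
    show "\<one>\<^bsub>M\<^esub> \<in> H" using w(1) by (auto simp: H_def G.act_one A.act_one intro: \<sigma>_refl)
    fix m n assume mn: "m \<in> H" "n \<in> H"
    then have c: "m \<in> carrier M" "n \<in> carrier M" by (auto simp: H_def)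
    have "(free_act M (w a) (m \<otimes>\<^bsub>M\<^esub> n), w (act a (m \<otimes>\<^bsub>M\<^esub> n))) \<in> \<sigma>" if a: "a \<in> A" for a
    proof -
      have "(free_act M (free_act M (w a) m) n, free_act M (w (act a m)) n) \<in> \<sigma>"
        using mn a c by (auto simp: H_def intro: \<sigma>_act)
      moreover have "(free_act M (w (act a m)) n, w (act (act a m) n)) \<in> \<sigma>"
        using mn A.act_closed[OF a c(1)] by (auto simp: H_def)
      ultimately show ?thesis
        using \<sigma>_trans by (simp add: G.act_mult[OF w(1)[OF a] c] A.act_mult[OF a c])
    qed
    then show "m \<otimes>\<^bsub>M\<^esub> n \<in> H" using c by (simp add: H_def)
  qed
  moreover have "S \<subseteq> H"
  proof
    fix s assume s: "s \<in> S"
    then have sM: "s \<in> carrier M" using S(2) by blast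
    have "(free_act M (w a) s, w (act a s)) \<in> \<sigma>" if a: "a \<in> A" for a
    proof (cases "a \<in> C")
      case True
      then have "((Inr a, s), w (act a s)) \<in> \<sigma>" using R'\<sigma> s by (auto simp: R'_def T_def)
      then show ?thesis using True sM by (simp add: w_def free_act_def)
    next
      case False
      then have b: "a \<in> B" using a by (simp add: C_def)
      \<comment> \<open>Here \<open>w a\<close> lies in the image of \<iota>, so acting by
        \<open>s\<close> stays in that image and \<open>norm_\<iota>\<close> applies.\<close>
      show ?thesis
        using norm_\<iota>[OF F.act_closed[OF inv(1)[OF b] sM]] False
        by (simp add: \<iota>_act \<theta>(2)[OF inv(1)[OF b] sM] inv(2)[OF b] w_def)
    qed
    then show "s \<in> H" using sM by (simp add: H_def)
  qed
  ultimately have HM: "carrier M \<subseteq> H" using S(3) unfolding generated_submonoid_def by blast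
  have norm: "(p, w (h p)) \<in> \<sigma>" if "p \<in> G" for p
  proof -
    obtain y m where p: "p = (y, m)" "y \<in> Y" "m \<in> carrier M"
      using \<open>p \<in> G\<close> by (auto simp: G_def free_carrier_def)
    show ?thesis
    proof (cases y)
      case (Inl x)
      then have "(x, m) \<in> F" using p by (auto simp: Y_def F_def free_carrier_def)
      from norm_\<iota>[OF this] show ?thesis using Inl p by (simp add: \<iota>_def h_def)
    next
      case (Inr c)
      then have c: "c \<in> C" "c \<in> A" using p by (auto simp: Y_def C_def)
      \<comment> \<open>An element over the new symbol \<open>c\<close> is \<open>w c\<close> acted
        on by \<open>m\<close>, so membership of \<open>m\<close> in \<open>H\<close> is exactly
        what is required.\<close>
      then have "(free_act M (w c) m, w (act c m)) \<in> \<sigma>" using HM p(3) by (auto simp: H_def)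
      then show ?thesis using Inr p c by (simp add: w_def h_def free_act_def)
    qed
  qed
  \<comment> \<open>The kernel of \<open>h\<close> is the pullback of equality on \<open>A\<close>,
    hence a congruence; as it contains \<open>R'\<close>, it contains \<sigma>.
    \<open>Id_on A\<close> is used because the pulled-back relation has to be an equivalence on
    \<open>A\<close>.\<close>
  have "act_congruence M G (free_act M) {(p, q). p \<in> G \<and> q \<in> G \<and> (h p, h q) \<in> Id_on A}"
    by (rule act_congruence_pullback[where A' = A and act' = act])
      (use hA h_act G.monoid_act_axioms A.act_closed in
        \<open>auto simp: act_congruence_def equiv_def refl_on_def sym_def trans_def\<close>)
  moreover have "R' \<subseteq> {(p, q). p \<in> G \<and> q \<in> G \<and> (h p, h q) \<in> Id_on A}"
  proof -
    have "h p = h q" if "(p, q) \<in> R'" for p q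
      using that unfolding R'_def
    proof
      assume "(p, q) \<in> map_prod \<iota> \<iota> ` R"
      then obtain p' q' where pq: "(p', q') \<in> R" "p = \<iota> p'" "q = \<iota> q'" by auto
      have "(p', q') \<in> generated_congruence M F (free_act M) R"
        using pq(1) unfolding generated_congruence_def by blast
      moreover have "p' \<in> F" "q' \<in> F" using R pq(1) by auto
      ultimately show "h p = h q" using \<theta>(3) pq by (simp add: h\<iota>)
    next
      assume "(p, q) \<in> T"
      then obtain c s where cs: "c \<in> C" "s \<in> S" "p = (Inr c, s)" "q = w (act c s)"
        by (auto simp: T_def)
      then have "act c s \<in> A" using S(2) by (auto simp: C_def intro: A.act_closed)
      then have "h q = act c s" using cs(4) by (simp only: w(2))
      then show "h p = h q" using cs(3) by (simp add: h_def)
    qed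
    moreover have "p \<in> G" "q \<in> G" if "(p, q) \<in> R'" for p q using R' that by auto
    ultimately show ?thesis using hA by (intro subrelI) (simp add: Id_on_iff)
  qed
  ultimately have "\<sigma> \<subseteq> {(p, q). p \<in> G \<and> q \<in> G \<and> (h p, h q) \<in> Id_on A}"
    unfolding \<sigma>_def generated_congruence_def by (intro Inter_lower CollectI conjI)
  then have ker: "h p = h q" if "(p, q) \<in> \<sigma>" for p q using that by auto
  \<comment> \<open>If \<open>h p = h q\<close>, then \<open>p\<close> and \<open>q\<close> have the
    same normal form \<open>w (h p)\<close>, to which both are \<sigma>-related.\<close>
  have "h p = h q \<longleftrightarrow> (p, q) \<in> \<sigma>" if "p \<in> G" "q \<in> G" for p q
    using ker norm[OF that(1)] norm[OF that(2)] \<sigma>_sym \<sigma>_trans by metis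
  moreover have "h ` G = A"
    using hA by (auto intro: image_eqI[where f = h, OF w(2)[symmetric] w(1)])
  moreover have pres': "is_presentation M Y R'"
    using Y R' by (simp add: is_presentation_def G_def)
  ultimately have "act_defined_by M A act Y R'"
    using h_act unfolding act_defined_by_iff[OF A pres'] G_def[symmetric] \<sigma>_def[symmetric]
    by (intro exI[of _ h]) simp
  moreover have "finite Y" using XR(1) fin by (simp add: Y_def C_def)
  moreover have "finite R'" using XR(2) fin S(1) by (simp add: R'_def T_def C_def)
  ultimately show ?thesis using finitely_presented_actI[OF A _ _ pres'] by blast
qed

end
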